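(* Let $G$ be a finite directed graph with a global sink, with a fixed cyclic ordering of the outgoing edges at each non-sink vertex. A rotor configuration $\rho$ on $G$ is recurrent if and only if it is acyclic.
   Context: Directed graphs are finite; self-loops and multiple edges are allowed. A sink is a vertex of out-degree zero; a global sink is a sink $s$ such that from every other vertex there is a directed path leading to $s$. For each non-sink vertex $v$ a cyclic ordering of the edges emanating from $v$ is fixed, and $e^+$ denotes the edge following $e$ in it. A rotor configuration is a function $\rho$ assigning to each non-sink vertex $v$ an edge $\rho(v)$ emanating from $v$. It is acyclic if the edges $\rho(v)$ do not form any directed cycle. Routing a chip at a non-sink vertex $v$ for one step means replacing $\rho(v)$ by $\rho(v)^+$ and then moving the chip to the head of $\rho(v)^+$. A chip at the sink stops there. For a non-sink vertex $v$, the chip addition operator $E_v$ is the map on rotor configurations given by adding a chip at $v$ and routing it repeatedly until it reaches the sink (which always happens after finitely many steps). The operators $E_v$ commute. A chip configuration is a vector $\sigma$ of non-negative integers indexed by the non-sink vertices. For a chip configuration $\sigma$ and a rotor configuration $\rho$, $\sigma(\rho)=\left(\prod_{v\neq s}E_v^{\sigma(v)}\right)\rho$ (composition of operators), i.e. the rotor configuration obtained by adding $\sigma(v)$ chips at each vertex $v$ and routing them all to the sink. A rotor configuration $\rho$ is reachable from $\rho'$ if there is a chip configuration $\sigma$ with $\sigma(\rho')=\rho$. A rotor configuration $\rho$ is recurrent if it is reachable from any other rotor configuration $\rho'$. *)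

theory Defs
  imports
    "Graph_Theory.Digraph"
    "Graph_Theory.Arc_Walk"
    "HOL-Combinatorics.Orbits"
    "HOL-Library.FuncSet"
    "HOL-Library.While_Combinator"
begin

definition sink :: "('a, 'b) pre_digraph \<Rightarrow> 'a \<Rightarrow> bool" where
  "sink G v \<longleftrightarrow> v \<in> verts G \<and> out_degree G v = 0"

definition global_sink :: "('a, 'b) pre_digraph \<Rightarrow> 'a \<Rightarrow> bool" where
  "global_sink G s \<longleftrightarrow> sink G s \<and> (\<forall>v \<in> verts G - {s}. v \<rightarrow>\<^sup>*\<^bsub>G\<^esub> s)"

definition nonsinks :: "('a, 'b) pre_digraph \<Rightarrow> 'a set" where
  "nonsinks G = {v \<in> verts G. \<not> sink G v}"

(* nxt e is the edge following e in the cyclic ordering of the edges emanating from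
   its tail. On a finite set, being cyclic_on means acting on it as a single cycle. *)
definition rotor_order :: "('a, 'b) pre_digraph \<Rightarrow> ('b \<Rightarrow> 'b) \<Rightarrow> bool" where
  "rotor_order G nxt \<longleftrightarrow> (\<forall>v \<in> nonsinks G. cyclic_on nxt (out_arcs G v))"

(* Extensional functions, so that equality of functions is equality of configurations. *)
definition rotor_configs :: "('a, 'b) pre_digraph \<Rightarrow> ('a \<Rightarrow> 'b) set" where
  "rotor_configs G = (\<Pi>\<^sub>E v \<in> nonsinks G. out_arcs G v)"

definition acyclic_rotor :: "('a, 'b) pre_digraph \<Rightarrow> ('a \<Rightarrow> 'b) \<Rightarrow> bool" where
  "acyclic_rotor G \<rho> \<longleftrightarrow> (\<nexists>c. pre_digraph.cycle G c \<and> set c \<subseteq> \<rho> ` nonsinks G)"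

fun route_step ::
  "('a, 'b) pre_digraph \<Rightarrow> ('b \<Rightarrow> 'b) \<Rightarrow> 'a \<times> ('a \<Rightarrow> 'b) \<Rightarrow> 'a \<times> ('a \<Rightarrow> 'b)" where
  "route_step G nxt (v, \<rho>) = (head G (nxt (\<rho> v)), \<rho>(v := nxt (\<rho> v)))"

definition chip_add ::
  "('a, 'b) pre_digraph \<Rightarrow> ('b \<Rightarrow> 'b) \<Rightarrow> 'a \<Rightarrow> ('a \<Rightarrow> 'b) \<Rightarrow> ('a \<Rightarrow> 'b)" where
  "chip_add G nxt v \<rho> = snd (while (\<lambda>(w, _). \<not> sink G w) (route_step G nxt) (v, \<rho>))"

(* The composition of the operators chip_add G nxt v ^^ \<sigma> v over all non-sink vertices v,
   which commute on rotor configurations. A chip configuration is a function into nat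
   of which only the values on non-sink vertices matter. *)
definition chip_action ::
  "('a, 'b) pre_digraph \<Rightarrow> ('b \<Rightarrow> 'b) \<Rightarrow> ('a \<Rightarrow> nat) \<Rightarrow> ('a \<Rightarrow> 'b) \<Rightarrow> ('a \<Rightarrow> 'b)" where
  "chip_action G nxt \<sigma> \<rho> = Finite_Set.fold (\<lambda>v. chip_add G nxt v ^^ \<sigma> v) \<rho> (nonsinks G)"

definition rotor_reachable ::
  "('a, 'b) pre_digraph \<Rightarrow> ('b \<Rightarrow> 'b) \<Rightarrow> ('a \<Rightarrow> 'b) \<Rightarrow> ('a \<Rightarrow> 'b) \<Rightarrow> bool" where
  "rotor_reachable G nxt \<rho>' \<rho> \<longleftrightarrow> (\<exists>\<sigma>. chip_action G nxt \<sigma> \<rho>' = \<rho>)"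

definition rotor_recurrent ::
  "('a, 'b) pre_digraph \<Rightarrow> ('b \<Rightarrow> 'b) \<Rightarrow> ('a \<Rightarrow> 'b) \<Rightarrow> bool" where
  "rotor_recurrent G nxt \<rho> \<longleftrightarrow> (\<forall>\<rho>' \<in> rotor_configs G - {\<rho>}. rotor_reachable G nxt \<rho>' \<rho>)"

end

theory Submission
  imports Defs
begin

text \<open>
  Describe a routing by its odometer \<open>u\<close>, the number of times each vertex sends out a chip: the
  current rotors and chips depend on the starting state and \<open>u\<close> alone. A legal odometer never
  exceeds one that removes all chips (least action), so the outcome of routing everything to the
  sink does not depend on the order. If an odometer removes all chips exactly but possibly
  illegally, and its final rotors are acyclic, it must coincide with the legal one: any surplus
  would be a circulation, while its last exits follow an acyclic configuration and carry chips
  into the sink.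

  To reach an acyclic \<open>\<rho>\<close> from \<open>\<rho>'\<close> it therefore suffices to find an odometer turning \<open>\<rho>'\<close> into
  \<open>\<rho>\<close> such that every vertex sends out at least as many chips as it receives; the difference is
  the required chip configuration. Conversely, throughout a routing the rotors lead from every
  vertex to a chip or to the sink if they do so initially, so the result is acyclic when the start
  is acyclic or carries a chip at every vertex.
\<close>

section \<open>Return times of an iterated map\<close>

text \<open>Any \<open>D\<close> consecutive iterates contain a hit, so the induction cuts off
  blocks of length \<open>D\<close>; the \<open>Suc\<close> pays for the incomplete last
  block.\<close>

lemma funpow_return_count:
  fixes f :: "'b \<Rightarrow> 'b"
  assumes hit: "\<And>e. e \<in> S \<Longrightarrow> \<exists>i<D. P ((f ^^ Suc i) e)"
    and closed: "\<And>e. e \<in> S \<Longrightarrow> f e \<in> S"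
    and "e \<in> S"
  shows "n < D * Suc (\<Sum>i<n. of_bool (P ((f ^^ Suc i) e)))"
  using \<open>e \<in> S\<close>
proof (induction n arbitrary: e rule: less_induct)
  case (less n)
  obtain i where i: "i < D" "P ((f ^^ Suc i) e)" using hit less.prems by blast
  let ?c = "\<lambda>n e. \<Sum>i<n. (of_bool (P ((f ^^ Suc i) e)) :: nat)"
  show ?case
  proof (cases "n < D")
    case True
    then show ?thesis by (simp add: trans_less_add1)
  next
    case False
    have in_S: "(f ^^ k) e \<in> S" for k
      by (induction k) (use closed less.prems in auto)
    have "?c n e = ?c D e + (\<Sum>i\<in>{D..<n}. of_bool (P ((f ^^ Suc i) e)))"
      using False by (metis lessThan_atLeast0 linorder_not_less sum.atLeastLessThan_concat zero_le)
    also have "(\<Sum>i\<in>{D..<n}. (of_bool (P ((f ^^ Suc i) e)) :: nat)) = ?c (n - D) ((f ^^ D) e)"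
      using False sum.shift_bounds_nat_ivl[of "\<lambda>i. of_bool (P ((f ^^ Suc i) e)) :: nat" 0 D "n - D"]
      by (simp add: lessThan_atLeast0 funpow_add)
    finally have split: "?c n e = ?c D e + ?c (n - D) ((f ^^ D) e)" .
    have "?c D e \<ge> of_bool (P ((f ^^ Suc i) e))"
      using i by (intro member_le_sum) auto
    then have "?c D e \<ge> 1" using i by simp
    moreover have "n - D < D * Suc (?c (n - D) ((f ^^ D) e))"
      using False i in_S by (intro less.IH) auto
    moreover have "Suc (?c (n - D) ((f ^^ D) e)) \<le> ?c n e"
      using \<open>?c D e \<ge> 1\<close> unfolding split by linarith
    ultimately have "n - D < D * ?c n e"
      by (meson mult_le_mono2 order_less_le_trans)
    then show ?thesis using False by simp
  qed
qed

section \<open>Networks with a global sink\<close>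

locale rotor_network = fin_digraph G for G :: "('a, 'b) pre_digraph" +
  fixes s :: 'a and nxt :: "'b \<Rightarrow> 'b"
  assumes global_sink: "global_sink G s"
    and rotor_order: "rotor_order G nxt"
begin

text \<open>A vertex other than \<open>s\<close> has a path to \<open>s\<close>, hence an outgoing
  edge.\<close>

lemma sink_iff: "v \<in> verts G \<Longrightarrow> sink G v \<longleftrightarrow> v = s"
proof
  assume v: "v \<in> verts G" "sink G v"
  show "v = s"
  proof (rule ccontr)
    assume "v \<noteq> s"
    then have "v \<rightarrow>\<^sup>*\<^bsub>G\<^esub> s" using global_sink v by (auto simp: global_sink_def)
    then obtain w where "v \<rightarrow>\<^bsub>G\<^esub> w"
      using \<open>v \<noteq> s\<close> by (auto elim: converse_reachable_cases)
    then obtain e where "e \<in> out_arcs G v" by (auto simp: out_arcs_def)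
    then show False using v by (auto simp: sink_def out_degree_def card_eq_0_iff)
  qed
qed (use global_sink in \<open>auto simp: global_sink_def\<close>)

lemma nonsinks_eq: "nonsinks G = verts G - {s}"
  using sink_iff by (auto simp: nonsinks_def)

lemma sink_in_verts: "s \<in> verts G"
  using global_sink by (auto simp: global_sink_def sink_def)

lemma verts_eq: "verts G = insert s (nonsinks G)"
  using nonsinks_eq sink_in_verts by auto

lemma sink_notin_nonsinks: "s \<notin> nonsinks G"
  by (simp add: nonsinks_eq)

lemma finite_nonsinks: "finite (nonsinks G)"
  by (simp add: nonsinks_eq)

lemma cyclic_out_arcs: "v \<in> nonsinks G \<Longrightarrow> cyclic_on nxt (out_arcs G v)"
  using rotor_order by (auto simp: rotor_order_def)

lemma finite_rotor_configs: "finite (rotor_configs G)"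
  unfolding rotor_configs_def by (intro finite_PiE finite_nonsinks) auto

lemma rotor_in_out_arcs: "\<rho> \<in> rotor_configs G \<Longrightarrow> v \<in> nonsinks G \<Longrightarrow> \<rho> v \<in> out_arcs G v"
  by (auto simp: rotor_configs_def)

section \<open>Turning rotors and counting arrivals\<close>

definition turn :: "('a \<Rightarrow> 'b) \<Rightarrow> ('a \<Rightarrow> nat) \<Rightarrow> 'a \<Rightarrow> 'b" where
  "turn \<rho> u = (\<lambda>v. (nxt ^^ u v) (\<rho> v))"

text \<open>Vanishing off the non-sinks makes odometers with the same firings equal as
  functions.\<close>

definition odometer :: "('a \<Rightarrow> nat) \<Rightarrow> bool" where
  "odometer u \<longleftrightarrow> (\<forall>v. v \<notin> nonsinks G \<longrightarrow> u v = 0)"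

text \<open>The rotor turns before the chip moves, so the chips leave \<open>w\<close> through the iterates of
  \<open>nxt\<close> from the first one on.\<close>
definition inflow :: "('a \<Rightarrow> 'b) \<Rightarrow> ('a \<Rightarrow> nat) \<Rightarrow> 'a \<Rightarrow> nat" where
  "inflow \<rho> u v = (\<Sum>w\<in>nonsinks G. \<Sum>i<u w. of_bool (head G ((nxt ^^ Suc i) (\<rho> w)) = v))"

lemma turn_add: "turn (turn \<rho> u) u' = turn \<rho> (\<lambda>v. u v + u' v)"
  by (auto simp: turn_def fun_eq_iff funpow_add add.commute[of "u _"])

lemma turn_zero [simp]: "turn \<rho> (\<lambda>_. 0) = \<rho>"
  by (simp add: turn_def)

lemma turn_upd: "turn \<rho> (u(v := Suc (u v))) = (turn \<rho> u)(v := nxt (turn \<rho> u v))"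
  by (auto simp: turn_def)

lemma turn_in_rotor_configs:
  assumes "\<rho> \<in> rotor_configs G" "odometer u"
  shows "turn \<rho> u \<in> rotor_configs G"
  using assms cyclic_on_funpow_in[OF cyclic_out_arcs]
  by (fastforce simp: rotor_configs_def turn_def odometer_def PiE_iff extensional_def)

text \<open>At each non-sink \<open>nxt\<close> runs cyclically through all outgoing edges, so any
  rotor can be turned into any other.\<close>

lemma turn_to_rotor_config:
  assumes "\<rho> \<in> rotor_configs G" "\<rho>' \<in> rotor_configs G"
  obtains u where "odometer u" "turn \<rho> u = \<rho>'"
proof -
  have "\<exists>n. (v \<notin> nonsinks G \<longrightarrow> n = 0) \<and> (nxt ^^ n) (\<rho> v) = \<rho>' v" for v
  proof (cases "v \<in> nonsinks G")
    case True
    then have "\<rho>' v \<in> orbit nxt (\<rho> v)"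
      using assms cyclic_out_arcs[OF True] rotor_in_out_arcs unfolding cyclic_on_alldef by blast
    then show ?thesis using True by (auto simp: orbit_altdef)
  next
    case False
    then show ?thesis using assms by (auto simp: rotor_configs_def PiE_iff extensional_def)
  qed
  then obtain u where "\<And>v. (v \<notin> nonsinks G \<longrightarrow> u v = 0) \<and> (nxt ^^ u v) (\<rho> v) = \<rho>' v" by metis
  then show thesis by (intro that[of u]) (auto simp: odometer_def turn_def)
qed

lemma inflow_zero [simp]: "inflow \<rho> (\<lambda>_. 0) v = 0"
  by (simp add: inflow_def)

text \<open>A cocycle identity: the firings after \<open>u\<close> start from the rotors
  \<open>turn \<rho> u\<close>.\<close>

lemma inflow_add: "inflow \<rho> (\<lambda>v. u v + u' v) x = inflow \<rho> u x + inflow (turn \<rho> u) u' x"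
proof -
  have "(\<Sum>i<m + n. (of_bool (head G ((nxt ^^ Suc i) e) = x) :: nat)) =
    (\<Sum>i<m. of_bool (head G ((nxt ^^ Suc i) e) = x)) +
    (\<Sum>i<n. of_bool (head G ((nxt ^^ Suc i) ((nxt ^^ m) e)) = x))" for m n e
  proof (induction n)
    case (Suc n)
    have "(nxt ^^ Suc (m + n)) e = (nxt ^^ Suc n) ((nxt ^^ m) e)"
      by (simp add: funpow_add add.commute[of m])
    then show ?case using Suc by simp
  qed simp
  then show ?thesis by (simp only: inflow_def turn_def sum.distrib)
qed

lemma inflow_mono: "(\<And>v. u v \<le> u' v) \<Longrightarrow> inflow \<rho> u x \<le> inflow \<rho> u' x"
  unfolding inflow_def by (intro sum_mono sum_mono2) auto

lemma inflow_single:
  assumes "v \<in> nonsinks G"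
  shows "inflow \<rho> (\<lambda>x. of_bool (x = v)) y = of_bool (head G (nxt (\<rho> v)) = y)"
proof -
  have "inflow \<rho> (\<lambda>x. of_bool (x = v)) y =
    (\<Sum>w\<in>nonsinks G. if w = v then of_bool (head G (nxt (\<rho> v)) = y) else 0)"
    unfolding inflow_def by (intro sum.cong) (auto simp: lessThan_Suc)
  then show ?thesis using assms by (simp add: finite_nonsinks)
qed

lemma inflow_upd:
  assumes "v \<in> nonsinks G"
  shows "inflow \<rho> (u(v := Suc (u v))) y = inflow \<rho> u y + of_bool (head G (nxt (turn \<rho> u v)) = y)"
proof -
  have "u(v := Suc (u v)) = (\<lambda>x. u x + of_bool (x = v))" by auto
  then show ?thesis using inflow_add inflow_single[OF assms] by simp
qed

text \<open>Conservation of chips: each firing delivers one chip to exactly one vertex, so double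
  counting applies.\<close>

lemma sum_inflow:
  assumes "\<rho> \<in> rotor_configs G"
  shows "(\<Sum>v\<in>verts G. inflow \<rho> u v) = (\<Sum>w\<in>nonsinks G. u w)"
proof -
  have *: "(\<Sum>v\<in>verts G. of_bool (head G ((nxt ^^ i) (\<rho> w)) = v)) = (1::nat)"
    if "w \<in> nonsinks G" for w i
  proof -
    have "(nxt ^^ i) (\<rho> w) \<in> out_arcs G w"
      using assms that by (intro cyclic_on_funpow_in[OF cyclic_out_arcs] rotor_in_out_arcs)
    then have "head G ((nxt ^^ i) (\<rho> w)) \<in> verts G" by (auto simp: out_arcs_def)
    then show ?thesis by (simp add: of_bool_def)
  qed
  have "(\<Sum>v\<in>verts G. inflow \<rho> u v) =
    (\<Sum>w\<in>nonsinks G. \<Sum>i<u w. \<Sum>v\<in>verts G. of_bool (head G ((nxt ^^ Suc i) (\<rho> w)) = v))"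
    unfolding inflow_def
    by (subst sum.swap) (intro sum.cong refl sum.swap)
  also have "\<dots> = (\<Sum>w\<in>nonsinks G. \<Sum>i<u w. 1)"
    by (intro sum.cong refl *)
  finally show ?thesis by simp
qed

section \<open>Acyclic rotor configurations\<close>

definition rotor_graph :: "('a \<Rightarrow> 'b) \<Rightarrow> ('a, 'b) pre_digraph" where
  "rotor_graph \<rho> = G\<lparr>arcs := \<rho> ` nonsinks G\<rparr>"

definition rotor_rel :: "('a \<Rightarrow> 'b) \<Rightarrow> ('a \<times> 'a) set" where
  "rotor_rel \<rho> = (\<lambda>x. (x, head G (\<rho> x))) ` nonsinks G"

text \<open>The cycles of \<open>G\<close> along rotors are exactly the cycles of the subgraph
  \<open>rotor_graph \<rho>\<close>, and a closed walk there contains a cycle.\<close>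

lemma acyclic_rotor_iff_acyclic:
  assumes "\<rho> \<in> rotor_configs G"
  shows "acyclic_rotor G \<rho> \<longleftrightarrow> acyclic (rotor_rel \<rho>)"
proof -
  let ?H = "rotor_graph \<rho>"
  have arcs: "\<rho> x \<in> arcs G" "tail G (\<rho> x) = x" if "x \<in> nonsinks G" for x
    using rotor_in_out_arcs[OF assms that] by (auto simp: out_arcs_def)
  interpret H: wf_digraph ?H
    by unfold_locales (use arcs in \<open>auto simp: rotor_graph_def nonsinks_def\<close>)
  have ends: "arcs_ends ?H = rotor_rel \<rho>"
    using arcs by (force simp: arcs_ends_def arc_to_ends_def rotor_graph_def rotor_rel_def)
  have cas: "H.cas x p y \<longleftrightarrow> cas x p y" for x p y
    by (induction p arbitrary: x) (auto simp: pre_digraph.cas.simps rotor_graph_def)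
  have verts: "H.awalk_verts x p = awalk_verts x p" for x p
    by (induction p arbitrary: x) (auto simp: pre_digraph.awalk_verts.simps rotor_graph_def)
  have "H.awalk x p y \<longleftrightarrow> awalk x p y \<and> set p \<subseteq> \<rho> ` nonsinks G" for x p y
    using arcs unfolding H.awalk_def awalk_def cas by (auto simp: rotor_graph_def)
  then have "H.cycle c \<longleftrightarrow> cycle c \<and> set c \<subseteq> \<rho> ` nonsinks G" for c
    unfolding H.cycle_def cycle_def verts by auto
  then have "acyclic_rotor G \<rho> \<longleftrightarrow> (\<nexists>c. H.cycle c)" by (simp add: acyclic_rotor_def)
  also have "\<dots> \<longleftrightarrow> (\<nexists>p. H.closed_w p)"
    using H.closed_w_imp_cycle H.cycle_altdef by blast
  also have "\<dots> \<longleftrightarrow> acyclic (rotor_rel \<rho>)"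
    unfolding acyclic_def H.closed_w_def ends[symmetric] H.reachable1_awalk by auto
  finally show ?thesis .
qed

text \<open>In an acyclic configuration, following the rotors must stop, and only \<open>s\<close>
  has no rotor. Conversely, a vertex on a cycle of rotors can never leave it, so it cannot reach
  \<open>s\<close>.\<close>

lemma acyclic_rotor_iff_reaches_sink:
  assumes "\<rho> \<in> rotor_configs G"
  shows "acyclic_rotor G \<rho> \<longleftrightarrow> (\<forall>x\<in>verts G. (x, s) \<in> (rotor_rel \<rho>)\<^sup>*)"
  unfolding acyclic_rotor_iff_acyclic[OF assms]
proof
  assume "acyclic (rotor_rel \<rho>)"
  then have "wf ((rotor_rel \<rho>)\<inverse>)"
    by (intro finite_acyclic_wf_converse) (auto simp: rotor_rel_def finite_nonsinks)
  then have "x \<in> verts G \<Longrightarrow> (x, s) \<in> (rotor_rel \<rho>)\<^sup>*" for x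
  proof (induction x rule: wf_induct_rule)
    case (less x)
    show ?case
    proof (cases "x = s")
      case False
      then have x: "x \<in> nonsinks G" using less.prems by (simp add: nonsinks_eq)
      then have "(x, head G (\<rho> x)) \<in> rotor_rel \<rho>" by (auto simp: rotor_rel_def)
      moreover have "head G (\<rho> x) \<in> verts G"
        using rotor_in_out_arcs[OF assms x] by (auto simp: out_arcs_def)
      ultimately show ?thesis using less.IH by (meson converse_iff converse_rtrancl_into_rtrancl)
    qed simp
  qed
  then show "\<forall>x\<in>verts G. (x, s) \<in> (rotor_rel \<rho>)\<^sup>*" by blast
next
  assume reach: "\<forall>x\<in>verts G. (x, s) \<in> (rotor_rel \<rho>)\<^sup>*"
  have "(x, x) \<notin> (rotor_rel \<rho>)\<^sup>+" if "(x, s) \<in> (rotor_rel \<rho>)\<^sup>*" for x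
    using that
  proof (induction rule: converse_rtrancl_induct)
    case base
    show ?case using sink_notin_nonsinks by (auto simp: rotor_rel_def dest: tranclD)
  next
    case (step x y)
    show ?case
    proof
      assume "(x, x) \<in> (rotor_rel \<rho>)\<^sup>+"
      then obtain z where "(x, z) \<in> rotor_rel \<rho>" "(z, x) \<in> (rotor_rel \<rho>)\<^sup>*" by (meson tranclD)
      \<comment> \<open>Each vertex has a single rotor, so a cycle through \<open>x\<close> also
        passes through \<open>y\<close>.\<close>
      moreover from this step.hyps have "z = y" by (auto simp: rotor_rel_def)
      ultimately show False using step by (meson rtrancl_into_trancl1)
    qed
  qed
  moreover have "x \<in> verts G" if "(x, x) \<in> (rotor_rel \<rho>)\<^sup>+" for x
    using tranclD[OF that] by (auto simp: rotor_rel_def nonsinks_eq)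
  ultimately show "acyclic (rotor_rel \<rho>)" using reach by (auto simp: acyclic_def)
qed

section \<open>Legal and stabilizing odometers\<close>

text \<open>The odometers of the routings that start from chips \<open>\<sigma>\<close> and rotors \<open>\<rho>\<close> and never fire
  a vertex without a chip.\<close>
inductive legal :: "('a \<Rightarrow> nat) \<Rightarrow> ('a \<Rightarrow> 'b) \<Rightarrow> ('a \<Rightarrow> nat) \<Rightarrow> bool"
  for \<sigma> \<rho> where
  zero: "legal \<sigma> \<rho> (\<lambda>_. 0)"
| fire: "legal \<sigma> \<rho> u \<Longrightarrow> v \<in> nonsinks G \<Longrightarrow> u v < \<sigma> v + inflow \<rho> u v \<Longrightarrow>
    legal \<sigma> \<rho> (u(v := Suc (u v)))"

text \<open>No legality is required: intermediate chip counts may be negative.\<close>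
definition stabilizing :: "('a \<Rightarrow> nat) \<Rightarrow> ('a \<Rightarrow> 'b) \<Rightarrow> ('a \<Rightarrow> nat) \<Rightarrow> bool" where
  "stabilizing \<sigma> \<rho> u \<longleftrightarrow> odometer u \<and> (\<forall>v\<in>nonsinks G. u v = \<sigma> v + inflow \<rho> u v)"

text \<open>An outcome independent of any routing strategy; that one exists rests on
  termination.\<close>

definition routes_to :: "('a \<Rightarrow> nat) \<Rightarrow> ('a \<Rightarrow> 'b) \<Rightarrow> ('a \<Rightarrow> 'b) \<Rightarrow> bool" where
  "routes_to \<sigma> \<rho> \<rho>' \<longleftrightarrow> (\<exists>u. legal \<sigma> \<rho> u \<and> stabilizing \<sigma> \<rho> u \<and> turn \<rho> u = \<rho>')"

lemma legal_odometer: "legal \<sigma> \<rho> u \<Longrightarrow> odometer u"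
  by (induction rule: legal.induct) (auto simp: odometer_def)

lemma legal_le: "legal \<sigma> \<rho> u \<Longrightarrow> v \<in> nonsinks G \<Longrightarrow> u v \<le> \<sigma> v + inflow \<rho> u v"
  by (induction rule: legal.induct) (auto simp: inflow_upd)

lemma legal_mono: "legal \<sigma> \<rho> u \<Longrightarrow> (\<And>v. v \<in> nonsinks G \<Longrightarrow> \<sigma> v \<le> \<sigma>' v) \<Longrightarrow> legal \<sigma>' \<rho> u"
  by (induction rule: legal.induct) (auto intro!: legal.intros intro: order_less_le_trans)

text \<open>The last premise bounds \<sigma>' by the chips left after \<open>u\<close>, in additive
  form to avoid truncated subtraction.\<close>

lemma legal_trans:
  assumes "legal \<sigma> \<rho> u" "legal \<sigma>' (turn \<rho> u) u'"
    and "\<And>v. v \<in> nonsinks G \<Longrightarrow> \<sigma>' v + u v \<le> \<sigma> v + inflow \<rho> u v"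
  shows "legal \<sigma> \<rho> (\<lambda>v. u v + u' v)"
  using assms(2)
proof (induction rule: legal.induct)
  case zero
  then show ?case using assms by simp
next
  case (fire u' v)
  have "(\<lambda>x. u x + (u'(v := Suc (u' v))) x) = (\<lambda>x. u x + u' x)(v := Suc (u v + u' v))"
    by auto
  moreover have "legal \<sigma> \<rho> ((\<lambda>x. u x + u' x)(v := Suc (u v + u' v)))"
    using fire assms(3)[of v] by (intro legal.fire) (auto simp: inflow_add)
  ultimately show ?case by simp
qed

text \<open>If \<open>u\<close> is below \<open>u'\<close> and \<open>w\<close> may fire, then
  \<open>u w < \<sigma> w + inflow \<rho> u w \<le> \<sigma> w + inflow \<rho> u' w = u' w\<close>,
  which leaves room for one more firing.\<close>

lemma least_action:
  assumes "legal \<sigma> \<rho> u" "stabilizing \<sigma> \<rho> u'"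
  shows "u v \<le> u' v"
  using assms(1)
proof (induction arbitrary: v rule: legal.induct)
  case (fire u w)
  have "u w < u' w"
    using fire inflow_mono[of u u' \<rho> w] assms(2) by (fastforce simp: stabilizing_def)
  then show ?case using fire.IH by simp
qed simp

text \<open>By least action, two legal stabilizing odometers bound each other.\<close>

lemma routes_to_unique: "routes_to \<sigma> \<rho> \<rho>1 \<Longrightarrow> routes_to \<sigma> \<rho> \<rho>2 \<Longrightarrow> \<rho>1 = \<rho>2"
  unfolding routes_to_def by (metis least_action antisym ext)

lemma stabilizing_add:
  assumes "stabilizing \<sigma> \<rho> u" "stabilizing \<sigma>' (turn \<rho> u) u'"
  shows "stabilizing (\<lambda>v. \<sigma> v + \<sigma>' v) \<rho> (\<lambda>v. u v + u' v)"
  using assms by (auto simp: stabilizing_def odometer_def inflow_add)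

text \<open>Routing one batch after the other is a legal way to route both; together with uniqueness
  this yields commutation.\<close>

lemma routes_to_add:
  assumes "routes_to \<sigma> \<rho> \<rho>'" "routes_to \<sigma>' \<rho>' \<rho>''"
  shows "routes_to (\<lambda>v. \<sigma> v + \<sigma>' v) \<rho> \<rho>''"
proof -
  obtain u u' where u: "legal \<sigma> \<rho> u" "stabilizing \<sigma> \<rho> u" "turn \<rho> u = \<rho>'"
    and u': "legal \<sigma>' \<rho>' u'" "stabilizing \<sigma>' \<rho>' u'" "turn \<rho>' u' = \<rho>''"
    using assms by (auto simp: routes_to_def)
  have "legal (\<lambda>v. \<sigma> v + \<sigma>' v) \<rho> u" using u(1) by (rule legal_mono) simp
  then have "legal (\<lambda>v. \<sigma> v + \<sigma>' v) \<rho> (\<lambda>v. u v + u' v)"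
    using u u' by (intro legal_trans) (auto simp: stabilizing_def)
  moreover have "stabilizing (\<lambda>v. \<sigma> v + \<sigma>' v) \<rho> (\<lambda>v. u v + u' v)"
    using u u' by (intro stabilizing_add) auto
  moreover have "turn \<rho> (\<lambda>v. u v + u' v) = \<rho>''" using u u' turn_add by metis
  ultimately show ?thesis unfolding routes_to_def by blast
qed

lemma routes_to_zero: "routes_to (\<lambda>_. 0) \<rho> \<rho>"
  unfolding routes_to_def
  by (rule exI[of _ "\<lambda>_. 0"]) (auto simp: stabilizing_def odometer_def intro: legal.zero)

lemma routes_to_cong:
  assumes "\<And>v. v \<in> nonsinks G \<Longrightarrow> \<sigma> v = \<sigma>' v"
  shows "routes_to \<sigma> \<rho> \<rho>' \<longleftrightarrow> routes_to \<sigma>' \<rho> \<rho>'"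
proof -
  have "legal \<sigma> \<rho> u \<longleftrightarrow> legal \<sigma>' \<rho> u" for u
    using assms legal_mono[of \<sigma> \<rho> u \<sigma>'] legal_mono[of \<sigma>' \<rho> u \<sigma>] by auto
  then show ?thesis using assms by (simp add: routes_to_def stabilizing_def)
qed

lemma routes_to_in_rotor_configs:
  "routes_to \<sigma> \<rho> \<rho>' \<Longrightarrow> \<rho> \<in> rotor_configs G \<Longrightarrow> \<rho>' \<in> rotor_configs G"
  unfolding routes_to_def by (metis legal_odometer turn_in_rotor_configs)

section \<open>Termination and the chip operators\<close>

text \<open>A vertex that fires often keeps sending chips along each of its edges, so a bound passes
  from the next vertex on a path to the sink to its predecessor.\<close>
lemma odometer_bounded:
  assumes \<rho>: "\<rho> \<in> rotor_configs G" and x: "x \<in> verts G"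
  shows "\<exists>B. \<forall>u. odometer u \<and> (\<forall>y\<in>verts G. inflow \<rho> u y \<le> u y + 1) \<longrightarrow> u x \<le> B"
proof -
  have "x \<rightarrow>\<^sup>*\<^bsub>G\<^esub> s"
    using global_sink x sink_in_verts by (cases "x = s") (auto simp: global_sink_def)
  then show ?thesis
  proof (induction rule: converse_reachable_induct)
    case base
    show ?case using sink_notin_nonsinks by (auto simp: odometer_def)
  next
    case (step x y)
    then obtain B where B: "\<And>u. odometer u \<Longrightarrow> \<forall>y\<in>verts G. inflow \<rho> u y \<le> u y + 1 \<Longrightarrow> u y \<le> B"
      by blast
    obtain e where e: "e \<in> out_arcs G x" "head G e = y"
      using step.hyps(1) by (auto simp: out_arcs_def)
    have y: "y \<in> verts G" using e by (auto simp: out_arcs_def)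
    show ?case
    proof (cases "x \<in> nonsinks G")
      case x: True
      have "\<exists>i. (nxt ^^ Suc i) a = e" if "a \<in> out_arcs G x" for a
      proof -
        have "e \<in> orbit nxt a" using that e cyclic_out_arcs[OF x] unfolding cyclic_on_alldef by blast
        then show ?thesis by (auto simp: orbit_altdef gr0_conv_Suc)
      qed
      then obtain f where f: "\<And>a. a \<in> out_arcs G x \<Longrightarrow> (nxt ^^ Suc (f a)) a = e" by metis
      \<comment> \<open>\<open>D\<close> exceeds every \<open>f a\<close>, so any \<open>D\<close>
        consecutive exits from \<open>x\<close> include one along \<open>e\<close>.\<close>
      define D where "D = Suc (\<Sum>a\<in>out_arcs G x. f a)"
      have fD: "f a < D" if "a \<in> out_arcs G x" for a
        unfolding D_def using member_le_sum[of a "out_arcs G x" f] that finite_cyclic_on[OF cyclic_out_arcs[OF x]] by simp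
      have "u x \<le> D * Suc (B + 1)"
        if u: "odometer u" "\<forall>y\<in>verts G. inflow \<rho> u y \<le> u y + 1" for u
      proof -
        let ?c = "\<Sum>i<u x. of_bool (head G ((nxt ^^ Suc i) (\<rho> x)) = y) :: nat"
        have "u x < D * Suc ?c"
        proof (rule funpow_return_count[where S = "out_arcs G x"])
          show "\<exists>i<D. head G ((nxt ^^ Suc i) a) = y" if "a \<in> out_arcs G x" for a
            using that e f fD by metis
        qed (use x \<rho> rotor_in_out_arcs cyclic_on_inI[OF cyclic_out_arcs] in auto)
        moreover have "?c \<le> inflow \<rho> u y"
          unfolding inflow_def using x finite_nonsinks
          by (intro member_le_sum[where f = "\<lambda>w. \<Sum>i<u w. of_bool (head G ((nxt ^^ Suc i) (\<rho> w)) = y)"]) auto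
        moreover have "inflow \<rho> u y \<le> B + 1" using B[OF u] u(2) y by fastforce
        ultimately show ?thesis by (meson Suc_le_mono le_trans less_imp_le mult_le_mono2)
      qed
      then show ?thesis by blast
    qed (auto simp: odometer_def)
  qed
qed

text \<open>The loop is a legal routing with one chip in flight. Its odometer after \<open>t\<close>
  steps has total \<open>t\<close>, and \<open>odometer_bounded\<close> bounds this total, so the
  chip reaches the sink.\<close>

lemma routes_to_chip_add:
  assumes \<rho>: "\<rho> \<in> rotor_configs G" and v: "v \<in> nonsinks G"
  shows "routes_to (\<lambda>x. of_bool (x = v)) \<rho> (chip_add G nxt v \<rho>)"
proof -
  let ?one = "\<lambda>x. of_bool (x = v) :: nat"
  let ?X = "\<lambda>t. (route_step G nxt ^^ t) (v, \<rho>)"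
  \<comment> \<open>The last clause is conservation: the only chip sits at the current vertex. It
    covers \<open>s\<close> too, as \<open>odometer_bounded\<close> asks for all vertices.\<close>
  let ?inv = "\<lambda>t u. legal ?one \<rho> u \<and> fst (?X t) \<in> verts G \<and> snd (?X t) = turn \<rho> u \<and>
    (\<Sum>x\<in>nonsinks G. u x) = t \<and>
    (\<forall>x\<in>verts G. ?one x + inflow \<rho> u x = u x + of_bool (x = fst (?X t)))"
  have inv: "\<exists>u. ?inv t u" if "\<And>t'. t' < t \<Longrightarrow> fst (?X t') \<noteq> s" for t
    using that
  proof (induction t)
    case 0
    show ?case using v by (intro exI[of _ "\<lambda>_. 0"]) (auto simp: nonsinks_eq intro: legal.zero)
  next
    case (Suc t)
    have "\<exists>u. ?inv t u" by (rule Suc.IH) (rule Suc.prems, simp)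
    then obtain u where u: "?inv t u" by blast
    obtain w \<rho>' where X: "?X t = (w, \<rho>')" by fastforce
    have w: "w \<in> nonsinks G" using u Suc.prems[of t] X by (auto simp: nonsinks_eq)
    have \<rho>': "\<rho>' = turn \<rho> u" using u X by simp
    have XS: "?X (Suc t) = (head G (nxt (\<rho>' w)), \<rho>'(w := nxt (\<rho>' w)))"
      using X by simp
    have "turn \<rho> u w \<in> out_arcs G w"
      using u \<rho> w legal_odometer turn_in_rotor_configs rotor_in_out_arcs by metis
    then have h: "nxt (turn \<rho> u w) \<in> out_arcs G w"
      using cyclic_on_inI[OF cyclic_out_arcs] w by blast
    have "legal ?one \<rho> (u(w := Suc (u w)))"
      using u w X by (intro legal.fire) (auto simp: nonsinks_eq)
    moreover have "(\<Sum>x\<in>nonsinks G. (u(w := Suc (u w))) x) = Suc t"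
      using u w finite_nonsinks by (simp add: sum.remove[of _ w])
    moreover have "?one x + inflow \<rho> (u(w := Suc (u w))) x =
        (u(w := Suc (u w))) x + of_bool (x = fst (?X (Suc t)))" if "x \<in> verts G" for x
      using u that w X unfolding XS \<rho>' inflow_upd[OF w] by (cases "x = w") auto
    ultimately show ?case
      using h by (intro exI[of _ "u(w := Suc (u w))"]) (auto simp: XS \<rho>' turn_upd out_arcs_def simp del: fun_upd_apply funpow.simps)
  qed
  have sink_s: "sink G s" using global_sink by (simp add: global_sink_def)
  have ex: "\<exists>t. sink G (fst (?X t))"
  proof (rule ccontr)
    assume "\<not> ?thesis"
    then have "fst (?X t) \<noteq> s" for t using sink_s by metis
    then have all: "\<exists>u. ?inv t u" for t by (intro inv) blast
    obtain B where B: "\<And>x u. x \<in> verts G \<Longrightarrow> odometer u \<Longrightarrow>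
        \<forall>y\<in>verts G. inflow \<rho> u y \<le> u y + 1 \<Longrightarrow> u x \<le> B x"
      using odometer_bounded[OF \<rho>] by metis
    \<comment> \<open>One step more than the bounds on the single vertices permit together.\<close>
    obtain u where u: "?inv (Suc (\<Sum>x\<in>nonsinks G. B x)) u" using all by blast
    have "inflow \<rho> u y \<le> u y + 1" if "y \<in> verts G" for y
    proof -
      have "inflow \<rho> u y \<le> ?one y + inflow \<rho> u y" by simp
      also have "\<dots> = u y + of_bool (y = fst (?X (Suc (\<Sum>x\<in>nonsinks G. B x))))"
        using u that by blast
      finally show ?thesis by (rule order_trans) simp
    qed
    then have "u x \<le> B x" if "x \<in> nonsinks G" for x
      using that u legal_odometer by (intro B) (auto simp: nonsinks_eq)
    then have "(\<Sum>x\<in>nonsinks G. u x) \<le> (\<Sum>x\<in>nonsinks G. B x)" by (rule sum_mono)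
    then show False using u by simp
  qed
  define T where "T = (LEAST t. sink G (fst (?X t)))"
  have "sink G (fst (?X T))" unfolding T_def using ex by (rule LeastI_ex)
  moreover have "\<not> sink G (fst (?X t))" if "t < T" for t
    using that unfolding T_def by (rule not_less_Least)
  then obtain u where u: "?inv T u" using inv sink_s by metis
  ultimately have X_T: "fst (?X T) = s" using sink_iff by blast
  \<comment> \<open>\<open>while\<close> returns the iterate at the first exit time, which is
    \<open>T\<close>.\<close>
  have "chip_add G nxt v \<rho> = snd (?X T)"
    using ex unfolding chip_add_def while_def while_option_def T_def by (simp add: case_prod_beta)
  then have "chip_add G nxt v \<rho> = turn \<rho> u" using u by simp
  moreover have "stabilizing ?one \<rho> u"
    using u X_T legal_odometer by (auto simp: stabilizing_def nonsinks_eq)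
  ultimately show ?thesis using u by (auto simp: routes_to_def)
qed

lemma routes_to_funpow_chip_add:
  assumes "\<rho> \<in> rotor_configs G" "v \<in> nonsinks G"
  shows "routes_to (\<lambda>x. if x = v then n else 0) \<rho> ((chip_add G nxt v ^^ n) \<rho>)"
proof (induction n)
  case 0
  then show ?case using routes_to_zero by simp
next
  case (Suc n)
  have "routes_to (\<lambda>x. of_bool (x = v)) ((chip_add G nxt v ^^ n) \<rho>)
      (chip_add G nxt v ((chip_add G nxt v ^^ n) \<rho>))"
    using routes_to_in_rotor_configs[OF Suc] assms by (intro routes_to_chip_add) auto
  moreover have "(\<lambda>x. if x = v then Suc n else 0) = (\<lambda>x. (if x = v then n else 0) + of_bool (x = v))"
    by auto
  ultimately show ?case using routes_to_add[OF Suc] by (simp only: funpow.simps o_apply)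
qed

lemma routes_to_chip_action:
  assumes \<rho>: "\<rho> \<in> rotor_configs G"
  shows "routes_to \<sigma> \<rho> (chip_action G nxt \<sigma> \<rho>)"
proof -
  \<comment> \<open>Being the identity off the non-sinks and the rotor configurations,
    \<open>g\<close> commutes without side conditions, so its fold can be evaluated one vertex at a
    time.\<close>
  define g where "g v \<rho> = (if v \<in> nonsinks G \<and> \<rho> \<in> rotor_configs G
    then (chip_add G nxt v ^^ \<sigma> v) \<rho> else \<rho>)" for v \<rho>
  have g: "routes_to (\<lambda>x. if x = v then \<sigma> v else 0) \<rho> (g v \<rho>)"
    if "\<rho> \<in> rotor_configs G" "v \<in> nonsinks G" for v \<rho>
    using that routes_to_funpow_chip_add by (simp add: g_def)
  have g_in: "g v \<rho> \<in> rotor_configs G" if "\<rho> \<in> rotor_configs G" for v \<rho>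
    using that g routes_to_in_rotor_configs by (cases "v \<in> nonsinks G") (blast, simp add: g_def)
  have comm: "g y (g x \<rho>) = g x (g y \<rho>)" for x y \<rho>
  proof (cases "\<rho> \<in> rotor_configs G \<and> x \<in> nonsinks G \<and> y \<in> nonsinks G")
    case True
    \<comment> \<open>Both orders route the same chips in total, so the outcomes agree.\<close>
    then show ?thesis
      using routes_to_add[OF g[of \<rho> x] g[of "g x \<rho>" y]] routes_to_add[OF g[of \<rho> y] g[of "g y \<rho>" x]] g_in
      by (simp add: add.commute routes_to_unique)
  qed (auto simp: g_def)
  interpret comp_fun_commute_on UNIV g
    by unfold_locales (auto simp: comm)
  have "routes_to (\<lambda>x. if x \<in> A then \<sigma> x else 0) \<rho> (Finite_Set.fold g \<rho> A)"
    if "finite A" "A \<subseteq> nonsinks G" for A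
    using that
  proof (induction A)
    case empty
    then show ?case using routes_to_zero by simp
  next
    case (insert v A)
    then have IH: "routes_to (\<lambda>x. if x \<in> A then \<sigma> x else 0) \<rho> (Finite_Set.fold g \<rho> A)" by simp
    have "routes_to (\<lambda>x. if x = v then \<sigma> v else 0) (Finite_Set.fold g \<rho> A)
        (Finite_Set.fold g \<rho> (insert v A))"
      using insert g[OF routes_to_in_rotor_configs[OF IH \<rho>]] by simp
    moreover have "(\<lambda>x. if x \<in> insert v A then \<sigma> x else 0) =
        (\<lambda>x. (if x \<in> A then \<sigma> x else 0) + (if x = v then \<sigma> v else 0))"
      using insert by auto
    ultimately show ?case using routes_to_add[OF IH] by (simp only:)
  qed
  moreover have "chip_action G nxt \<sigma> \<rho> = Finite_Set.fold g \<rho> (nonsinks G)"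
    unfolding chip_action_def
  proof (rule fold_closed_eq[where B = "rotor_configs G"])
    show "(chip_add G nxt a ^^ \<sigma> a) b = g a b" if "a \<in> nonsinks G" "b \<in> rotor_configs G" for a b
      using that by (simp add: g_def)
  qed (use g_in \<rho> in auto)
  ultimately show ?thesis
    using finite_nonsinks routes_to_cong[of "\<lambda>x. if x \<in> nonsinks G then \<sigma> x else 0" \<sigma>] by auto
qed

section \<open>Uniqueness of an acyclic outcome\<close>

text \<open>The surplus \<open>d\<close> brings nothing into the sink, and if \<open>d x > 0\<close> then the last firing of \<open>x\<close>
  goes along the final rotor of \<open>x\<close>; hence \<open>d\<close> vanishes backwards along the final rotors.\<close>
lemma legal_stabilizing_eq:
  assumes \<rho>: "\<rho> \<in> rotor_configs G"
    and "legal \<sigma> \<rho> u" "stabilizing \<sigma> \<rho> u" "stabilizing \<sigma> \<rho> u'"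
    and acyclic: "acyclic_rotor G (turn \<rho> u')"
  shows "u = u'"
proof -
  define d where "d v = u' v - u v" for v
  \<comment> \<open>Least action shows that no subtraction in \<open>d\<close> is truncated.\<close>
  have u': "u' = (\<lambda>v. u v + d v)" using least_action assms by (simp add: d_def fun_eq_iff)
  define \<rho>1 where "\<rho>1 = turn \<rho> u"
  have \<rho>1: "\<rho>1 \<in> rotor_configs G"
    using assms turn_in_rotor_configs by (auto simp: \<rho>1_def stabilizing_def)
  have d: "odometer d" using assms by (auto simp: d_def odometer_def stabilizing_def)
  have d_eq: "d v = inflow \<rho>1 d v" if "v \<in> nonsinks G" for v
  proof -
    have "u v + d v = \<sigma> v + inflow \<rho> u v + inflow \<rho>1 d v"
      using assms(4) that unfolding stabilizing_def u' inflow_add \<rho>1_def by simp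
    then show ?thesis using assms(3) that unfolding stabilizing_def by simp
  qed
  \<comment> \<open>Conservation: \<open>d\<close> sends out as many chips as arrive anywhere, and
    by \<open>d_eq\<close> the non-sinks already account for all of them.\<close>
  have inflow_s: "inflow \<rho>1 d s = 0"
  proof -
    have "inflow \<rho>1 d s + (\<Sum>v\<in>nonsinks G. inflow \<rho>1 d v) = (\<Sum>v\<in>nonsinks G. d v)"
      using sum_inflow[OF \<rho>1, of d] finite_nonsinks sink_notin_nonsinks by (simp add: verts_eq)
    then show ?thesis using d_eq by simp
  qed
  have d_turn: "turn \<rho> u' = turn \<rho>1 d" by (simp add: turn_add \<rho>1_def u')
  have "inflow \<rho>1 d x = 0" if "(x, s) \<in> (rotor_rel (turn \<rho>1 d))\<^sup>*" for x
    using that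
  proof (induction rule: converse_rtrancl_induct)
    case (step x y)
    then have x: "x \<in> nonsinks G" and y: "y = head G ((nxt ^^ d x) (\<rho>1 x))"
      by (auto simp: rotor_rel_def turn_def)
    have "d x = 0"
    proof (rule ccontr)
      assume "d x \<noteq> 0"
      then obtain k where k: "d x = Suc k" by (cases "d x") auto
      have "(\<Sum>i<d x. of_bool (head G ((nxt ^^ Suc i) (\<rho>1 x)) = y)) = (0::nat)"
        using step.IH x finite_nonsinks unfolding inflow_def by (auto simp del: sum_of_bool_eq funpow.simps)
      then show False using k y by (auto simp del: sum_of_bool_eq funpow.simps)
    qed
    then show ?case using d_eq[OF x] by simp
  qed (rule inflow_s)
  moreover have "turn \<rho>1 d \<in> rotor_configs G" using \<rho>1 d by (rule turn_in_rotor_configs)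
  ultimately have "inflow \<rho>1 d v = 0" if "v \<in> nonsinks G" for v
    using that acyclic acyclic_rotor_iff_reaches_sink d_turn by (auto simp: nonsinks_eq)
  then have "d v = 0" for v using d d_eq by (cases "v \<in> nonsinks G") (auto simp: odometer_def)
  then show ?thesis by (simp add: u')
qed

section \<open>Acyclicity along routings\<close>

text \<open>Only the edge at \<open>v\<close> changes, so a path survives up to its first visit to
  \<open>v\<close>.\<close>

lemma rotor_rel_upd:
  assumes "(x, y) \<in> (rotor_rel \<rho>)\<^sup>*"
  shows "(x, y) \<in> (rotor_rel (\<rho>(v := e)))\<^sup>* \<or> (x, v) \<in> (rotor_rel (\<rho>(v := e)))\<^sup>*"
  using assms
proof (induction rule: converse_rtrancl_induct)
  case (step x z)
  show ?case
  proof (cases "x = v")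
    case False
    then have "(x, z) \<in> rotor_rel (\<rho>(v := e))" using step.hyps by (auto simp: rotor_rel_def)
    then show ?thesis using step.IH by (meson converse_rtrancl_into_rtrancl)
  qed simp
qed simp

text \<open>A firing turns the rotor of \<open>v\<close> to the edge its chip takes, so a path
  interrupted at \<open>v\<close> continues to that chip; other paths still end at a chip or at
  \<open>s\<close>.\<close>

lemma legal_reaches_chip:
  assumes "legal \<sigma> \<rho> u" and \<rho>: "\<rho> \<in> rotor_configs G" and x: "x \<in> verts G"
    and init: "\<exists>y. (x, y) \<in> (rotor_rel \<rho>)\<^sup>* \<and> (y = s \<or> y \<in> nonsinks G \<and> 0 < \<sigma> y)"
  shows "\<exists>y. (x, y) \<in> (rotor_rel (turn \<rho> u))\<^sup>* \<and>
    (y = s \<or> y \<in> nonsinks G \<and> u y < \<sigma> y + inflow \<rho> u y)"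
  using assms(1)
proof (induction rule: legal.induct)
  case zero
  then show ?case using init by simp
next
  case (fire u v)
  let ?u = "u(v := Suc (u v))" and ?e = "nxt (turn \<rho> u v)"
  let ?chip = "\<lambda>u y. y = s \<or> y \<in> nonsinks G \<and> u y < \<sigma> y + inflow \<rho> u y"
  obtain y where y: "(x, y) \<in> (rotor_rel (turn \<rho> u))\<^sup>*" "?chip u y" using fire.IH by blast
  have "turn \<rho> u v \<in> out_arcs G v"
    using fire \<rho> legal_odometer turn_in_rotor_configs rotor_in_out_arcs by metis
  then have "?e \<in> out_arcs G v" using cyclic_on_inI[OF cyclic_out_arcs] fire by blast
  then have head: "head G ?e \<in> verts G" by (auto simp: out_arcs_def)
  have edge: "(v, head G ?e) \<in> rotor_rel (turn \<rho> ?u)"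
    unfolding turn_upd using fire by (force simp: rotor_rel_def)
  \<comment> \<open>By legality the chip count there was not negative, so the arriving chip makes it
    positive. At a self-loop the chip that left \<open>v\<close> returns.\<close>
  have head_chip: "?chip ?u (head G ?e)"
    using head fire legal_le[OF fire(1), of "head G ?e"] unfolding inflow_upd[OF fire(2)]
    by (auto simp: nonsinks_eq)
  show ?case
  proof (cases "(x, v) \<in> (rotor_rel (turn \<rho> ?u))\<^sup>*")
    case True
    then have "(x, head G ?e) \<in> (rotor_rel (turn \<rho> ?u))\<^sup>*"
      using edge by (rule rtrancl_into_rtrancl)
    then show ?thesis using head_chip by blast
  next
    case False
    then have xy: "(x, y) \<in> (rotor_rel (turn \<rho> ?u))\<^sup>*"
      using rotor_rel_upd[OF y(1)] unfolding turn_upd by blast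
    then have "y \<noteq> v" using False by blast
    then have "?chip ?u y" using y(2) unfolding inflow_upd[OF fire(2)] by auto
    then show ?thesis using xy by blast
  qed
qed

text \<open>Once no chips are left, the only place the rotors can lead to is the sink. With a chip
  everywhere, the empty path serves initially.\<close>

lemma routes_to_acyclic:
  assumes \<rho>: "\<rho> \<in> rotor_configs G" and routes: "routes_to \<sigma> \<rho> \<rho>'"
    and init: "acyclic_rotor G \<rho> \<or> (\<forall>v\<in>nonsinks G. 0 < \<sigma> v)"
  shows "acyclic_rotor G \<rho>'"
proof -
  obtain u where u: "legal \<sigma> \<rho> u" "stabilizing \<sigma> \<rho> u" "turn \<rho> u = \<rho>'"
    using routes by (auto simp: routes_to_def)
  have "(x, s) \<in> (rotor_rel \<rho>')\<^sup>*" if x: "x \<in> verts G" for x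
  proof -
    have "\<exists>y. (x, y) \<in> (rotor_rel \<rho>)\<^sup>* \<and> (y = s \<or> y \<in> nonsinks G \<and> 0 < \<sigma> y)"
      using init x acyclic_rotor_iff_reaches_sink[OF \<rho>] by (auto simp: verts_eq)
    from legal_reaches_chip[OF u(1) \<rho> x this] show ?thesis
      using u(2,3) by (auto simp: stabilizing_def)
  qed
  then show ?thesis
    using acyclic_rotor_iff_reaches_sink routes_to_in_rotor_configs[OF routes \<rho>] by blast
qed

text \<open>One chip on every vertex produces an acyclic configuration; \<rho> equals it or is
  reachable from it, and routing preserves acyclicity.\<close>

lemma recurrent_imp_acyclic:
  assumes \<rho>: "\<rho> \<in> rotor_configs G" and rec: "rotor_recurrent G nxt \<rho>"
  shows "acyclic_rotor G \<rho>"
proof -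
  define \<rho>' where "\<rho>' = chip_action G nxt (\<lambda>_. 1) \<rho>"
  have routes: "routes_to (\<lambda>_. 1) \<rho> \<rho>'"
    unfolding \<rho>'_def using \<rho> by (rule routes_to_chip_action)
  have \<rho>': "\<rho>' \<in> rotor_configs G" using routes \<rho> by (rule routes_to_in_rotor_configs)
  have acyclic: "acyclic_rotor G \<rho>'" using routes_to_acyclic[OF \<rho> routes] by simp
  show ?thesis
  proof (cases "\<rho>' = \<rho>")
    case False
    then obtain \<sigma> where "chip_action G nxt \<sigma> \<rho>' = \<rho>"
      using rec \<rho>' by (auto simp: rotor_recurrent_def rotor_reachable_def)
    then have "routes_to \<sigma> \<rho>' \<rho>" using routes_to_chip_action[OF \<rho>'] by metis
    then show ?thesis using routes_to_acyclic[OF \<rho>'] acyclic by blast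
  qed (use acyclic in simp)
qed

section \<open>Reaching acyclic configurations\<close>

text \<open>Adding one chip everywhere again and again must repeat a rotor configuration.\<close>
lemma gaining_loop:
  assumes \<rho>: "\<rho> \<in> rotor_configs G"
  obtains \<rho>' m where "\<rho>' \<in> rotor_configs G" "odometer m" "turn \<rho>' m = \<rho>'"
    "\<And>v. v \<in> nonsinks G \<Longrightarrow> inflow \<rho>' m v < m v"
proof -
  let ?E = "chip_action G nxt (\<lambda>_. 1)"
  have E_in: "(?E ^^ n) \<rho> \<in> rotor_configs G" for n
    by (induction n)
      (use \<rho> routes_to_in_rotor_configs[OF routes_to_chip_action[of _ "\<lambda>_. 1"]] in auto)
  have routes: "routes_to (\<lambda>_. p) ((?E ^^ a) \<rho>) ((?E ^^ (a + p)) \<rho>)" for a p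
  proof (induction p)
    case (Suc p)
    from routes_to_add[OF Suc routes_to_chip_action[OF E_in, of "\<lambda>_. 1"]] show ?case by simp
  qed (simp add: routes_to_zero)
  have "\<not> inj (\<lambda>n. (?E ^^ n) \<rho>)"
  proof
    assume "inj (\<lambda>n. (?E ^^ n) \<rho>)"
    moreover have "finite (range (\<lambda>n. (?E ^^ n) \<rho>))"
      using E_in by (intro finite_subset[OF _ finite_rotor_configs]) blast
    ultimately show False using finite_imageD infinite_UNIV_nat by blast
  qed
  then obtain a b where "a < b" and eq: "(?E ^^ a) \<rho> = (?E ^^ b) \<rho>"
    unfolding inj_on_def by (metis linorder_neqE_nat)
  then obtain p where p: "b = a + p" "0 < p" using less_imp_add_positive by blast
  \<comment> \<open>The odometer of the \<open>p\<close> rounds between the repetitions; stability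
    gives \<open>m v = p + inflow\<close> at non-sinks, a strict gain as \<open>p\<close> is
    positive.\<close>
  obtain m where m: "stabilizing (\<lambda>_. p) ((?E ^^ a) \<rho>) m" "turn ((?E ^^ a) \<rho>) m = (?E ^^ a) \<rho>"
    using routes[of p a] eq p by (auto simp: routes_to_def)
  show thesis
    using m p(2) E_in by (intro that[of "(?E ^^ a) \<rho>" m]) (auto simp: stabilizing_def)
qed

text \<open>Every repetition starts from the same rotors, so the contributions just add up.\<close>

lemma inflow_loop:
  assumes "turn \<rho> m = \<rho>"
  shows "turn \<rho> (\<lambda>v. k * m v) = \<rho> \<and> inflow \<rho> (\<lambda>v. k * m v) x = k * inflow \<rho> m x"
proof (induction k)
  case (Suc k)
  have "(\<lambda>v. Suc k * m v) = (\<lambda>v. m v + k * m v)" by auto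
  moreover have "turn \<rho> (\<lambda>v. m v + k * m v) = \<rho>"
    using Suc assms turn_add[of \<rho> m "\<lambda>v. k * m v"] by metis
  moreover have "inflow \<rho> (\<lambda>v. m v + k * m v) x = Suc k * inflow \<rho> m x"
    using Suc assms by (simp add: inflow_add)
  ultimately show ?case by (simp only:)
qed simp

lemma acyclic_imp_reachable:
  assumes \<rho>: "\<rho> \<in> rotor_configs G" and acyclic: "acyclic_rotor G \<rho>"
    and \<rho>': "\<rho>' \<in> rotor_configs G"
  shows "rotor_reachable G nxt \<rho>' \<rho>"
proof -
  obtain \<rho>0 m where \<rho>0: "\<rho>0 \<in> rotor_configs G" and m: "odometer m" "turn \<rho>0 m = \<rho>0"
    and gain: "\<And>v. v \<in> nonsinks G \<Longrightarrow> inflow \<rho>0 m v < m v"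
    using gaining_loop[OF \<rho>] by blast
  obtain c where c: "odometer c" "turn \<rho>' c = \<rho>0" using turn_to_rotor_config[OF \<rho>' \<rho>0] by blast
  obtain c' where c': "odometer c'" "turn \<rho>0 c' = \<rho>" using turn_to_rotor_config[OF \<rho>0 \<rho>] by blast
  define b where "b v = inflow \<rho>' c v + inflow \<rho>0 c' v" for v
  \<comment> \<open>Each turn of the loop gains at least one firing over the arrivals at every
    non-sink, so \<open>k\<close> turns offset the arrivals \<open>b v\<close> caused by
    \<open>c\<close> and \<open>c'\<close>.\<close>
  define k where "k = (\<Sum>v\<in>nonsinks G. b v)"
  define u where "u = (\<lambda>v. c v + (k * m v + c' v))"
  \<comment> \<open>The chips to be added: the excess of departures over arrivals, shown below not
    to be truncated at non-sinks.\<close>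
  define \<sigma> where "\<sigma> v = u v - inflow \<rho>' u v" for v
  have turn_u: "turn \<rho>' u = \<rho>"
    unfolding u_def using c c' inflow_loop[OF m(2)] turn_add by metis
  have "inflow \<rho>' u v \<le> u v" if v: "v \<in> nonsinks G" for v
  proof -
    have "inflow \<rho>' u v = b v + k * inflow \<rho>0 m v"
      unfolding u_def inflow_add c(2) using inflow_loop[OF m(2)] by (simp add: b_def)
    also have "b v \<le> k" unfolding k_def using v finite_nonsinks by (intro member_le_sum) auto
    then have "b v + k * inflow \<rho>0 m v \<le> k * Suc (inflow \<rho>0 m v)" by simp
    also have "\<dots> \<le> k * m v" using gain[OF v] by (intro mult_le_mono2) simp
    finally show ?thesis by (simp add: u_def)
  qed
  then have u: "stabilizing \<sigma> \<rho>' u"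
    using c(1) c'(1) m(1) by (auto simp: stabilizing_def \<sigma>_def odometer_def u_def)
  obtain w where "legal \<sigma> \<rho>' w" "stabilizing \<sigma> \<rho>' w" "turn \<rho>' w = chip_action G nxt \<sigma> \<rho>'"
    using routes_to_chip_action[OF \<rho>'] unfolding routes_to_def by blast
  \<comment> \<open>Although \<open>u\<close> itself need not be legal, its final rotors \<rho> are
    acyclic, so it agrees with the legal routing of \<sigma>.\<close>
  moreover from this have "w = u"
    using legal_stabilizing_eq[OF \<rho>' _ _ u] acyclic turn_u by simp
  ultimately show ?thesis using turn_u by (auto simp: rotor_reachable_def)
qed

end

theorem lemma3p15:
  fixes G :: "('a, 'b) pre_digraph" and s :: 'a and nxt :: "'b \<Rightarrow> 'b" and \<rho> :: "'a \<Rightarrow> 'b"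
  assumes "fin_digraph G"
    and "global_sink G s"
    and "rotor_order G nxt"
    and "\<rho> \<in> rotor_configs G"
  shows "rotor_recurrent G nxt \<rho> \<longleftrightarrow> acyclic_rotor G \<rho>"
proof -
  interpret rotor_network G s nxt
    using assms by (auto simp: rotor_network_def rotor_network_axioms_def)
  show ?thesis
    using assms(4) recurrent_imp_acyclic acyclic_imp_reachable
    by (auto simp: rotor_recurrent_def)
qed

end
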